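(* For every integer $n\ge 0$, the number of ways to tile an $n$-board using half-squares and $(\frac12,\frac12)$-fences equals $F_{n+1}^2$.
   Context: The Fibonacci numbers are $F_0=0$, $F_1=1$, $F_n=F_{n-1}+F_{n-2}$ for $n\ge2$. An $n$-board is a $1\times n$ array of $n$ unit square cells in a row (horizontal extent $[0,n]$). A half-square is a tile of width $\frac12$ and height $1$, covering a horizontal interval $[x,x+\frac12]$. A $(\frac12,\frac12)$-fence is a single tile composed of two pieces (posts), each of width $\frac12$ and height $1$, separated by a gap of width $\frac12$; it covers $[x,x+\frac12]\cup[x+1,x+\frac32]$ for some $x$. Tiles are not rotated. Tiles need not be aligned with the cell boundaries, and the gap of a fence must be covered by other tiles. A tiling covers the board exactly, with no overlaps (of interiors), no uncovered region and nothing protruding from the board. There is exactly one (empty) tiling of the $0$-board. *)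

theory Defs
  imports "HOL-Analysis.Analysis" "HOL-Number_Theory.Fib"
begin

text \<open>
  The board and all tiles have height 1 and tiles are not rotated, so a placed tile is determined
  by its shape and the (arbitrary real) abscissa of its left edge, and it is described by its
  horizontal extent.
\<close>

datatype tile = Half_Square real | Fence real

fun extent :: "tile \<Rightarrow> real set" where
  "extent (Half_Square x) = {x .. x + 1/2}"
| "extent (Fence x) = {x .. x + 1/2} \<union> {x + 1 .. x + 3/2}"

text \<open>
  Coverage is required only on the open interval, so that the empty set is a tiling of the 0-board,
  whose closed extent is the single point 0. For \<open>n > 0\<close> the endpoints are covered anyway: extents
  are closed, and disjointness of the interiors leaves room for only finitely many tiles.
\<close>

definition tiling :: "nat \<Rightarrow> tile set \<Rightarrow> bool" where
  "tiling n T \<longleftrightarrow>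
     pairwise (\<lambda>s t. interior (extent s) \<inter> interior (extent t) = {}) T \<and>
     {0 <..< real n} \<subseteq> (\<Union>t\<in>T. extent t) \<and>
     (\<Union>t\<in>T. extent t) \<subseteq> {0 .. real n}"

end

theory Submission
  imports Defs
begin

text \<open>
  Since no gaps are left and every post has width 1/2, the posts of a tiling occupy exactly the
  2n half-cells of the board. A fence then occupies half-cells i and i + 2, which have the same
  parity, so a tiling splits into two independent tilings of an n-board by squares and dominoes,
  one on the even and one on the odd half-cells. Each of the two can be chosen in
  \<open>fib (n + 1)\<close> ways.
\<close>

section \<open>Tiles as unions of posts\<close>

text \<open>A post is represented by its left edge alone, as all posts have width 1/2.\<close>

fun posts :: "tile \<Rightarrow> real set" where
  "posts (Half_Square x) = {x}"
| "posts (Fence x) = {x, x + 1}"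

lemma extent_eq_posts: "extent t = (\<Union>p\<in>posts t. {p..p + 1/2})"
  by (cases t) (auto simp: field_simps)

lemma finite_posts [simp]: "finite (posts t)"
  by (cases t) auto

lemma finite_Icc_Int_adjacent:
  fixes p q :: real
  assumes "d \<le> \<bar>p - q\<bar>"
  shows "finite ({p..p + d} \<inter> {q..q + d})"
proof -
  have "{p..p + d} \<inter> {q..q + d} \<subseteq> {p, q}"
    using assms by auto
  then show ?thesis
    using finite_subset by blast
qed

text \<open>Posts at least 1/2 apart meet at most in endpoints, so the intersection of the interiors
  is finite and open, hence empty. Conversely, two posts closer than 1/2 share an open
  interval.\<close>

lemma interior_extent_disjoint_iff:
  "interior (extent s) \<inter> interior (extent t) = {} \<longleftrightarrow>
     (\<forall>p\<in>posts s. \<forall>q\<in>posts t. 1/2 \<le> \<bar>p - q\<bar>)"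
proof
  assume disj: "interior (extent s) \<inter> interior (extent t) = {}"
  show "\<forall>p\<in>posts s. \<forall>q\<in>posts t. 1/2 \<le> \<bar>p - q\<bar>"
  proof (intro ballI, rule ccontr)
    fix p q
    assume p: "p \<in> posts s" and q: "q \<in> posts t" and lt: "\<not> 1/2 \<le> \<bar>p - q\<bar>"
    have sub: "{r<..<r + 1/2} \<subseteq> interior (extent u)" if "r \<in> posts u" for r u
      proof (rule interior_maximal)
      show "{r<..<r + 1/2} \<subseteq> extent u"
        using that greaterThanLessThan_subseteq_atLeastAtMost_iff[of r "r + 1/2" r "r + 1/2"]
        unfolding extent_eq_posts by fast
    qed simp
    have "p - q < 1/2" "q - p < 1/2"
      using lt unfolding not_le abs_diff_less_iff by linarith+
    \<comment> \<open>The witness is the midpoint of the overlap of the two posts.\<close>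
    then have "(p + q + 1/2) / 2 \<in> {p<..<p + 1/2} \<inter> {q<..<q + 1/2}"
      by (simp add: field_simps)
    then show False
      using sub[OF p] sub[OF q] disj by blast
  qed
next
  assume far: "\<forall>p\<in>posts s. \<forall>q\<in>posts t. 1/2 \<le> \<bar>p - q\<bar>"
  have "extent s \<inter> extent t = (\<Union>p\<in>posts s. \<Union>q\<in>posts t. {p..p + 1/2} \<inter> {q..q + 1/2})"
    unfolding extent_eq_posts by blast
  also have "finite \<dots>"
    by (intro finite_UN_I finite_posts finite_Icc_Int_adjacent) (use far in blast)
  finally have "finite (extent s \<inter> extent t)" .
  then have "finite (interior (extent s) \<inter> interior (extent t))"
    by (rule rev_finite_subset) (use interior_subset in blast)
  then show "interior (extent s) \<inter> interior (extent t) = {}"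
    using finite_imp_not_open by blast
qed

section \<open>Posts start at half-integers\<close>

text \<open>Rounding \<open>p\<close> down to the grid moves it by less than 1/2, so separation
  forces the two points to coincide.\<close>

lemma separated_half_integer_eq:
  assumes sep: "\<And>p q. p \<in> P \<Longrightarrow> q \<in> P \<Longrightarrow> p \<noteq> q \<Longrightarrow> 1/2 \<le> \<bar>p - q\<bar>"
    and p: "p \<in> P" "0 \<le> p"
    and grid: "real (nat \<lfloor>2 * p\<rfloor>) / 2 \<in> P"
  shows "p = real (nat \<lfloor>2 * p\<rfloor>) / 2"
proof (rule ccontr)
  assume "p \<noteq> real (nat \<lfloor>2 * p\<rfloor>) / 2"
  then have "1/2 \<le> \<bar>p - real (nat \<lfloor>2 * p\<rfloor>) / 2\<bar>"
    using sep p grid by blast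
  then show False
    using p(2) by (simp add: abs_if split: if_splits) linarith+
qed

text \<open>
  Once the half-cells to the left of \<open>k/2\<close> are occupied, points just to the right of \<open>k/2\<close> can only
  be covered by intervals starting in \<open>[k/2, k/2 + e]\<close>; if none of these started at \<open>k/2\<close> itself,
  there would be two of them at distance less than 1/2.
\<close>

lemma half_integers_in_separated_cover:
  fixes P :: "real set"
  assumes sep: "\<And>p q. p \<in> P \<Longrightarrow> q \<in> P \<Longrightarrow> p \<noteq> q \<Longrightarrow> 1/2 \<le> \<bar>p - q\<bar>"
    and nonneg: "\<And>p. p \<in> P \<Longrightarrow> 0 \<le> p"
    and cover: "{0<..<real n} \<subseteq> (\<Union>p\<in>P. {p..p + 1/2})"
  shows "k < 2 * n \<Longrightarrow> real k / 2 \<in> P"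
proof (induction k rule: less_induct)
  case (less k)
  have ge: "real k / 2 \<le> p" if p: "p \<in> P" and right: "real k / 2 < p + 1/2" for p
  proof (rule ccontr)
    assume lt: "\<not> real k / 2 \<le> p"
    \<comment> \<open>By the induction hypothesis the grid point just below \<open>p\<close> belongs
      to \<open>P\<close>, so \<open>p\<close> equals it. Then \<open>p\<close> is at most
      \<open>(k - 1)/2\<close>, and its interval ends no later than \<open>k/2\<close>.\<close>
    have *: "nat \<lfloor>2 * p\<rfloor> < k"
      using lt nonneg[OF p] by linarith
    then have "real (nat \<lfloor>2 * p\<rfloor>) / 2 \<in> P"
      using less by simp
    then have "p = real (nat \<lfloor>2 * p\<rfloor>) / 2"
      using separated_half_integer_eq[OF sep p nonneg[OF p]] by blast
    moreover have "real (nat \<lfloor>2 * p\<rfloor>) + 1 \<le> real k"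
      using * by linarith
    ultimately show False
      using right by linarith
  qed
  have near: "\<exists>p\<in>P. real k / 2 \<le> p \<and> p \<le> real k / 2 + e" if e: "0 < e" "e < 1/2" for e
  proof -
    have "real k / 2 + e \<in> {0<..<real n}"
      using less.prems e by auto
    then obtain p where "p \<in> P" "p \<le> real k / 2 + e" "real k / 2 + e \<le> p + 1/2"
      using cover by auto
    then show ?thesis
      using ge[of p] e by fastforce
  qed
  obtain p where p: "p \<in> P" "real k / 2 \<le> p" "p \<le> real k / 2 + 1/4"
    using near[of "1/4"] by auto
  show ?case
  proof (rule ccontr)
    assume "real k / 2 \<notin> P"
    with p have gt: "real k / 2 < p"
      by (metis order_le_less)
    \<comment> \<open>Halving the distance from \<open>k/2\<close> to \<open>p\<close> makes
      \<open>q\<close> start strictly before \<open>p\<close>, and still within 1/4 of it.\<close>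
    obtain q where q: "q \<in> P" "real k / 2 \<le> q" "q \<le> real k / 2 + (p - real k / 2) / 2"
      using near[of "(p - real k / 2) / 2"] p gt by auto
    then have "q < p" "p - q < 1/2"
      using p gt by (auto simp: field_simps)
    then show False
      using sep[OF p(1) q(1)] by auto
  qed
qed

section \<open>Tilings as exact covers of the half-cells\<close>

text \<open>This reduces the continuous problem to a finite one: \<open>k\<close> stands for the
  half-cell from \<open>k/2\<close> to \<open>(k + 1)/2\<close>, and each half-cell has exactly one
  owner.\<close>

lemma tiling_iff_half_cells:
  "tiling n T \<longleftrightarrow>
     (\<forall>k<2 * n. \<exists>!t. t \<in> T \<and> real k / 2 \<in> posts t) \<and>
     (\<forall>t\<in>T. \<forall>p\<in>posts t. \<exists>k<2 * n. p = real k / 2)"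
  (is "_ \<longleftrightarrow> ?unique \<and> ?grid")
proof
  assume T: "tiling n T"
  define P where "P = (\<Union>t\<in>T. posts t)"
  have far: "1/2 \<le> \<bar>p - q\<bar>"
    if "s \<in> T" "t \<in> T" "s \<noteq> t" "p \<in> posts s" "q \<in> posts t" for s t p q
    using T that unfolding tiling_def pairwise_def interior_extent_disjoint_iff by blast
  \<comment> \<open>Disjointness of distinct tiles says nothing about the two posts of one fence;
    these are at distance 1.\<close>
  have far_self: "1/2 \<le> \<bar>p - q\<bar>" if "p \<in> posts t" "q \<in> posts t" "p \<noteq> q" for p q t
    using that by (cases t) auto
  have sep: "1/2 \<le> \<bar>p - q\<bar>" if "p \<in> P" "q \<in> P" "p \<noteq> q" for p q
    using that far far_self unfolding P_def by blast
  have cover: "{0<..<real n} \<subseteq> (\<Union>p\<in>P. {p..p + 1/2})"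
    using T unfolding tiling_def extent_eq_posts P_def by auto
  have range: "0 \<le> p \<and> p + 1/2 \<le> real n" if p: "p \<in> P" for p
  proof -
    obtain t where "t \<in> T" "p \<in> posts t"
      using p unfolding P_def by blast
    then have "{p..p + 1/2} \<subseteq> {0..real n}"
      using T unfolding tiling_def extent_eq_posts by blast
    then show ?thesis
      by simp
  qed
  have mem: "real k / 2 \<in> P" if "k < 2 * n" for k
    using half_integers_in_separated_cover[OF sep _ cover that] range by blast
  have ?unique
  proof (intro allI impI ex_ex1I)
    fix k assume "k < 2 * n"
    then show "\<exists>t. t \<in> T \<and> real k / 2 \<in> posts t"
      using mem unfolding P_def by blast
  next
    fix k s t
    assume "s \<in> T \<and> real k / 2 \<in> posts s" "t \<in> T \<and> real k / 2 \<in> posts t"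
    then show "s = t"
      using far[of s t "real k / 2" "real k / 2"] by auto
  qed
  moreover have ?grid
  proof (intro ballI)
    fix t p assume "t \<in> T" "p \<in> posts t"
    then have p: "p \<in> P"
      unfolding P_def by blast
    \<comment> \<open>The post ends inside the board, so \<open>2 * p\<close> is at most
      \<open>2 * n - 1\<close>.\<close>
    have lt: "nat \<lfloor>2 * p\<rfloor> < 2 * n"
      using range[OF p] by linarith
    have "p = real (nat \<lfloor>2 * p\<rfloor>) / 2"
      by (rule separated_half_integer_eq[OF sep p _ mem[OF lt]]) (use range[OF p] in auto)
    with lt show "\<exists>k<2 * n. p = real k / 2"
      by blast
  qed
  ultimately show "?unique \<and> ?grid" ..
next
  assume T: "?unique \<and> ?grid"
  have "pairwise (\<lambda>s t. interior (extent s) \<inter> interior (extent t) = {}) T"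
    unfolding pairwise_def interior_extent_disjoint_iff
  proof (intro ballI impI)
    fix s t p q
    assume st: "s \<in> T" "t \<in> T" "s \<noteq> t" "p \<in> posts s" "q \<in> posts t"
    then obtain k l where k: "k < 2 * n" "p = real k / 2" and l: "l < 2 * n" "q = real l / 2"
      using T by meson
    have "k \<noteq> l"
      using T st k l by blast
    then have "1 \<le> \<bar>real k - real l\<bar>"
      by linarith
    then show "1/2 \<le> \<bar>p - q\<bar>"
      unfolding k l by (simp add: abs_if split: if_splits)
  qed
  moreover have "{0<..<real n} \<subseteq> (\<Union>t\<in>T. extent t)"
  proof
    fix x assume x: "x \<in> {0<..<real n}"
    then have "nat \<lfloor>2 * x\<rfloor> < 2 * n"
      by (auto simp: nat_less_iff floor_less_iff)
    then obtain t where t: "t \<in> T" "real (nat \<lfloor>2 * x\<rfloor>) / 2 \<in> posts t"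
      using T by blast
    have "x \<in> {real (nat \<lfloor>2 * x\<rfloor>) / 2 .. real (nat \<lfloor>2 * x\<rfloor>) / 2 + 1/2}"
      using x by (simp add: field_simps) linarith
    with t show "x \<in> (\<Union>t\<in>T. extent t)"
      unfolding extent_eq_posts by blast
  qed
  moreover have "(\<Union>t\<in>T. extent t) \<subseteq> {0..real n}"
  proof
    fix x assume "x \<in> (\<Union>t\<in>T. extent t)"
    then obtain t p where "t \<in> T" "p \<in> posts t" and x: "x \<in> {p..p + 1/2}"
      unfolding extent_eq_posts by blast
    then obtain k where "k < 2 * n" "p = real k / 2"
      using T by blast
    with x show "x \<in> {0..real n}"
      by auto
  qed
  ultimately show "tiling n T"
    unfolding tiling_def by blast
qed

section \<open>Tilings encoded by their fences\<close>

text \<open>A fence whose left post is in half-cell i has its right post in half-cell i + 2.\<close>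

definition fence_positions :: "nat \<Rightarrow> nat set set" where
  "fence_positions n = {F. \<forall>i\<in>F. i + 2 < 2 * n \<and> i + 2 \<notin> F}"

text \<open>The fences determine a tiling, since every half-cell left over can only hold a
  half-square.\<close>

definition tiling_of_fences :: "nat \<Rightarrow> nat set \<Rightarrow> tile set" where
  "tiling_of_fences n F =
     {Fence (real i / 2) | i. i \<in> F} \<union>
     {Half_Square (real i / 2) | i. i < 2 * n \<and> i \<notin> F \<and> (\<forall>j\<in>F. i \<noteq> j + 2)}"

lemma half_real_add_one_eq_iff: "real i / 2 + 1 = real j / 2 \<longleftrightarrow> j = i + 2"
  by linarith

lemma half_mem_posts_iff:
  "real k / 2 \<in> posts (Half_Square (real i / 2)) \<longleftrightarrow> k = i"
  "real k / 2 \<in> posts (Fence (real i / 2)) \<longleftrightarrow> k = i \<or> k = i + 2"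
  using half_real_add_one_eq_iff[of i k] by auto

text \<open>A half-cell is under a left post, under a right post, or free. The first two cases
  exclude each other because \<open>i + 2 \<notin> F\<close>, so the owner is unique.\<close>

lemma tiling_tiling_of_fences:
  assumes F: "F \<in> fence_positions n"
  shows "tiling n (tiling_of_fences n F)"
  unfolding tiling_iff_half_cells
proof (intro conjI allI impI ballI)
  fix k assume k: "k < 2 * n"
  have F': "i + 2 < 2 * n" "i + 2 \<notin> F" if "i \<in> F" for i
    using F that unfolding fence_positions_def by auto
  have fence: "Fence (real i / 2) \<in> tiling_of_fences n F" if "i \<in> F" for i
    using that unfolding tiling_of_fences_def by blast
  consider (left) "k \<in> F" | (right) j where "j \<in> F" "k = j + 2"
    | (square) "k \<notin> F" "\<forall>j\<in>F. k \<noteq> j + 2"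
    by blast
  then show "\<exists>!t. t \<in> tiling_of_fences n F \<and> real k / 2 \<in> posts t"
  proof cases
    case left
    show ?thesis
    proof (rule ex1I[of _ "Fence (real k / 2)"])
      show "Fence (real k / 2) \<in> tiling_of_fences n F \<and> real k / 2 \<in> posts (Fence (real k / 2))"
        using left fence by simp
      show "t = Fence (real k / 2)" if "t \<in> tiling_of_fences n F \<and> real k / 2 \<in> posts t" for t
        using that left F'(2)
        unfolding tiling_of_fences_def by (fastforce simp only: half_mem_posts_iff)
    qed
  next
    case right
    show ?thesis
    proof (rule ex1I[of _ "Fence (real j / 2)"])
      show "Fence (real j / 2) \<in> tiling_of_fences n F \<and> real k / 2 \<in> posts (Fence (real j / 2))"
        using right fence by simp
      show "t = Fence (real j / 2)" if "t \<in> tiling_of_fences n F \<and> real k / 2 \<in> posts t" for t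
        using that right F'(2)
        unfolding tiling_of_fences_def by (fastforce simp only: half_mem_posts_iff)
    qed
  next
    case square
    show ?thesis
    proof (rule ex1I[of _ "Half_Square (real k / 2)"])
      show "Half_Square (real k / 2) \<in> tiling_of_fences n F \<and>
          real k / 2 \<in> posts (Half_Square (real k / 2))"
        using square k unfolding tiling_of_fences_def by auto
      show "t = Half_Square (real k / 2)"
        if "t \<in> tiling_of_fences n F \<and> real k / 2 \<in> posts t" for t
        using that square
        unfolding tiling_of_fences_def by (fastforce simp only: half_mem_posts_iff)
    qed
  qed
next
  fix t p assume t: "t \<in> tiling_of_fences n F" and p: "p \<in> posts t"
  from t consider (fence) i where "i \<in> F" "t = Fence (real i / 2)"
    | (square) i where "i < 2 * n" "t = Half_Square (real i / 2)"
    unfolding tiling_of_fences_def by blast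
  then show "\<exists>k<2 * n. p = real k / 2"
  proof cases
    case fence
    then have "i + 2 < 2 * n"
      using F unfolding fence_positions_def by blast
    moreover from fence p have "p = real i / 2 \<or> p = real (i + 2) / 2"
      by auto
    ultimately show ?thesis
      by (metis add_lessD1)
  next
    case square
    with p show ?thesis
      by auto
  qed
qed

text \<open>The right post of a fence occupies half-cell \<open>i + 2\<close>, which therefore lies
  on the board and cannot hold the left post of another fence.\<close>

lemma fences_in_fence_positions:
  assumes T: "tiling n T"
  shows "{i. Fence (real i / 2) \<in> T} \<in> fence_positions n"
  unfolding fence_positions_def
proof (intro CollectI ballI conjI)
  fix i assume i: "i \<in> {i. Fence (real i / 2) \<in> T}"
  then obtain k where k: "k < 2 * n" "real i / 2 + 1 = real k / 2"
    using T unfolding tiling_iff_half_cells by fastforce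
  then show lt: "i + 2 < 2 * n"
    using half_real_add_one_eq_iff[of i k] by simp
  show "i + 2 \<notin> {i. Fence (real i / 2) \<in> T}"
  proof
    assume "i + 2 \<in> {i. Fence (real i / 2) \<in> T}"
    moreover have "real (i + 2) / 2 \<in> posts (Fence (real i / 2))"
      "real (i + 2) / 2 \<in> posts (Fence (real (i + 2) / 2))"
      by auto
    ultimately have "Fence (real i / 2) = Fence (real (i + 2) / 2)"
      using T i lt unfolding tiling_iff_half_cells by blast
    then show False
      by simp
  qed
qed

text \<open>The owner of a half-cell free of fence posts must be a half-square; conversely, by
  uniqueness, a half-square of \<open>T\<close> shares its half-cell with no fence.\<close>

lemma tiling_of_fences_fences:
  assumes T: "tiling n T"
  shows "tiling_of_fences n {i. Fence (real i / 2) \<in> T} = T" (is "tiling_of_fences n ?F = T")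
proof -
  have ex: "\<exists>t\<in>T. real k / 2 \<in> posts t" if "k < 2 * n" for k
    using T that unfolding tiling_iff_half_cells by blast
  have unique: "s = t"
    if "k < 2 * n" "s \<in> T" "t \<in> T" "real k / 2 \<in> posts s" "real k / 2 \<in> posts t" for s t k
    using T that unfolding tiling_iff_half_cells by blast
  have grid: "\<exists>k<2 * n. p = real k / 2" if "t \<in> T" "p \<in> posts t" for t p
    using T that unfolding tiling_iff_half_cells by blast
  show ?thesis
  proof (intro equalityI subsetI)
    fix t assume "t \<in> tiling_of_fences n ?F"
    then consider (fence) i where "i \<in> ?F" "t = Fence (real i / 2)"
      | (square) i where "i < 2 * n" "i \<notin> ?F" "\<forall>j\<in>?F. i \<noteq> j + 2" "t = Half_Square (real i / 2)"
      unfolding tiling_of_fences_def by blast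
    then show "t \<in> T"
    proof cases
      case fence
      then show ?thesis
        by simp
    next
      case square
      obtain s where s: "s \<in> T" "real i / 2 \<in> posts s"
        using ex square(1) by blast
      show ?thesis
      proof (cases s)
        case (Half_Square x)
        with s square show ?thesis
          by simp
      next
        case (Fence x)
        then obtain j where j: "x = real j / 2"
          using grid[OF s(1)] by fastforce
        then have "i = j \<or> i = j + 2"
          using s(2) Fence half_real_add_one_eq_iff[of j i] by auto
        moreover have "j \<in> ?F"
          using s Fence j by simp
        ultimately show ?thesis
          using square by blast
      qed
    qed
  next
    fix t assume t: "t \<in> T"
    show "t \<in> tiling_of_fences n ?F"
    proof (cases t)
      case (Fence x)
      then obtain i where "x = real i / 2"
        using grid[OF t] by fastforce
      with t Fence show ?thesis
        unfolding tiling_of_fences_def by blast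
    next
      case (Half_Square x)
      then obtain i where i: "i < 2 * n" "x = real i / 2"
        using grid[OF t] by fastforce
      have no_fence: "real i / 2 \<notin> posts (Fence y)" if "Fence y \<in> T" for y
        using unique[OF i(1) t that] Half_Square i(2) by auto
      have "i \<notin> ?F"
        using no_fence by fastforce
      moreover have "\<forall>j\<in>?F. i \<noteq> j + 2"
        using no_fence half_real_add_one_eq_iff by fastforce
      ultimately show ?thesis
        using Half_Square i unfolding tiling_of_fences_def by blast
    qed
  qed
qed

lemma bij_betw_tiling_of_fences:
  "bij_betw (tiling_of_fences n) (fence_positions n) {T. tiling n T}"
proof (rule bij_betw_byWitness[where f' = "\<lambda>T. {i. Fence (real i / 2) \<in> T}"])
  show "\<forall>F\<in>fence_positions n. {i. Fence (real i / 2) \<in> tiling_of_fences n F} = F"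
    by (auto simp: tiling_of_fences_def)
qed (auto simp: tiling_of_fences_fences tiling_tiling_of_fences fences_in_fence_positions)

section \<open>Counting square-domino tilings\<close>

text \<open>A tiling of an n-board by squares and dominoes, encoded by the left cells of its dominoes.\<close>

definition domino_positions :: "nat \<Rightarrow> nat set set" where
  "domino_positions n = {A. \<forall>i\<in>A. i + 1 < n \<and> i + 1 \<notin> A}"

text \<open>Case distinction on a domino covering the last two cells \<open>n\<close> and
  \<open>n + 1\<close>. Without it, all dominoes lie in the first \<open>n + 1\<close> cells; with
  it, the others lie in the first \<open>n\<close>.\<close>

lemma domino_positions_Suc_Suc:
  "domino_positions (Suc (Suc n)) =
     domino_positions (Suc n) \<union> insert n ` domino_positions n" (is "?L = ?R")
proof (intro equalityI subsetI)
  fix A assume A: "A \<in> ?L"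
  show "A \<in> ?R"
  proof (cases "n \<in> A")
    case True
    have "i + 1 < n" if "i \<in> A - {n}" for i
    proof -
      \<comment> \<open>\<open>i + 1 \<noteq> n\<close> holds because \<open>n \<in> A\<close>
        whereas \<open>i + 1 \<notin> A\<close>.\<close>
      have "i \<le> n" "i \<noteq> n" "i + 1 \<noteq> n"
        using A True that unfolding domino_positions_def by auto
      then show ?thesis
        by linarith
    qed
    then have "A - {n} \<in> domino_positions n"
      using A unfolding domino_positions_def by blast
    moreover have "A = insert n (A - {n})"
      using True by blast
    ultimately show ?thesis
      by blast
  next
    case False
    then show ?thesis
      using A unfolding domino_positions_def by (auto simp: less_Suc_eq)
  qed
qed (force simp: domino_positions_def)

lemma domino_positions_less: "A \<in> domino_positions n \<Longrightarrow> i \<in> A \<Longrightarrow> i + 1 < n"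
  unfolding domino_positions_def by blast

lemma finite_domino_positions: "finite (domino_positions n)"
proof (rule finite_subset)
  show "domino_positions n \<subseteq> Pow {..<n}"
    using domino_positions_less by fastforce
qed simp

lemma card_domino_positions: "card (domino_positions n) = fib (Suc n)"
proof (induction n rule: fib.induct)
  case 1
  have "domino_positions 0 = {{}}"
    by (auto simp: domino_positions_def)
  then show ?case
    by simp
next
  case 2
  have "domino_positions (Suc 0) = {{}}"
    by (auto simp: domino_positions_def)
  then show ?case
    by simp
next
  case (3 n)
  \<comment> \<open>Members of \<open>domino_positions (Suc n)\<close> contain only numbers below
    \<open>n\<close>.\<close>
  have disj: "domino_positions (Suc n) \<inter> insert n ` domino_positions n = {}"
    using domino_positions_less by fastforce
  have inj: "inj_on (insert n) (domino_positions n)"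
  proof (rule inj_onI)
    fix A B assume "A \<in> domino_positions n" "B \<in> domino_positions n" "insert n A = insert n B"
    moreover from this have "n \<notin> A" "n \<notin> B"
      using domino_positions_less by fastforce+
    ultimately show "A = B"
      by (metis insert_ident)
  qed
  have "card (domino_positions (Suc (Suc n))) =
      card (domino_positions (Suc n)) + card (domino_positions n)"
    unfolding domino_positions_Suc_Suc
    by (simp add: card_Un_disjoint disj finite_domino_positions card_image[OF inj])
  with 3 show ?case
    by simp
qed

section \<open>Splitting by parity\<close>

text \<open>Halving turns the step \<open>i + 2\<close> into \<open>i + 1\<close> within each parity
  class. The bounds agree too: both \<open>2 * i + 2 < 2 * n\<close> and
  \<open>2 * i + 3 < 2 * n\<close> amount to \<open>i + 1 < n\<close>.\<close>

lemma bij_betw_fence_positions: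
  "bij_betw (\<lambda>F. ({i. 2 * i \<in> F}, {i. 2 * i + 1 \<in> F}))
     (fence_positions n) (domino_positions n \<times> domino_positions n)"
proof (rule bij_betw_byWitness[where
      \<comment> \<open>The inverse interleaves the two sets.\<close>
      f' = "\<lambda>(A, B). {k. if even k then k div 2 \<in> A else k div 2 \<in> B}"])
  show "\<forall>F\<in>fence_positions n.
      (case ({i. 2 * i \<in> F}, {i. 2 * i + 1 \<in> F}) of
        (A, B) \<Rightarrow> {k. if even k then k div 2 \<in> A else k div 2 \<in> B}) = F"
    by auto
  show "(\<lambda>F. ({i. 2 * i \<in> F}, {i. 2 * i + 1 \<in> F})) ` fence_positions n
      \<subseteq> domino_positions n \<times> domino_positions n"
    by (fastforce simp: fence_positions_def domino_positions_def)
  show "(\<lambda>(A, B). {k. if even k then k div 2 \<in> A else k div 2 \<in> B}) `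
      (domino_positions n \<times> domino_positions n) \<subseteq> fence_positions n"
  proof clarify
    fix A B assume A: "A \<in> domino_positions n" and B: "B \<in> domino_positions n"
    show "{k. if even k then k div 2 \<in> A else k div 2 \<in> B} \<in> fence_positions n"
      unfolding fence_positions_def
    proof (intro CollectI ballI)
      fix k assume k: "k \<in> {k. if even k then k div 2 \<in> A else k div 2 \<in> B}"
      have "(k + 2) div 2 = k div 2 + 1"
        by simp
      then show "k + 2 < 2 * n \<and> k + 2 \<notin> {k. if even k then k div 2 \<in> A else k div 2 \<in> B}"
        using A B k unfolding domino_positions_def
        by (cases "even k") (auto elim!: evenE oddE dest!: bspec)
    qed
  qed
qed auto

theorem theorem3p2:
  fixes n :: nat
  shows "card {T. tiling n T} = (fib (n + 1))\<^sup>2"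
proof -
  have "card {T. tiling n T} = card (domino_positions n \<times> domino_positions n)"
    using bij_betw_same_card[OF bij_betw_tiling_of_fences]
      bij_betw_same_card[OF bij_betw_fence_positions] by metis
  then show ?thesis
    by (simp add: card_cartesian_product card_domino_positions power2_eq_square)
qed

end
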